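(* Let $q$ be a prime power, let $h_1,h_2$ be polynomials over $GF(q)$ with $h_2$ additive, and for $a\in GF(q)$ let $f_a(x)=h_1(x)+h_2(ax)+a^2x$. Suppose the set $\{f_a(x) \mid a\in GF(q)\}$ is of class $\Delta$, with integers $t,d$ as in the definition. Let $\varepsilon$ be a fixed primitive element of $GF(q)$. Then $f_a$ is a permutation polynomial of $GF(q)$ for all $a\in GF(q)$ if and only if $f_a$ is a permutation polynomial for $a=0$ and for $a=\varepsilon^r$ for all integers $0\le r<\gcd(q-1,\Delta d)$.
   Context: A polynomial $h$ over $GF(q)$ is additive if $h(x+u)=h(x)+h(u)$ for all $x,u\in GF(q)$. For a positive divisor $\Delta$ of $q-1$, a set of polynomials $\{f_a(x)\mid a\in GF(q)\}$ over $GF(q)$ is of class $\Delta$ if there exist integers $t$ and $d$ such that $f_a(bx)=b^t f_{ab^d}(x)$ for all $b\in GF(q)$ with $b^{(q-1)/\Delta}=1$ and all $a,x\in GF(q)$. A permutation polynomial is one inducing a bijection of $GF(q)$. *)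

theory Defs
  imports "HOL-Computational_Algebra.Computational_Algebra" "HOL-Library.Cardinality"
begin

(* GF(q) is a type of sorts field and finite, with q = CARD('a). *)

definition permutation_polynomial :: "'a::{field,finite} poly \<Rightarrow> bool" where
  "permutation_polynomial p \<longleftrightarrow> bij (poly p)"

(* The conjunct e \<noteq> 0 matters only for CARD('a) = 2, where 0 ^ 0 = 1 would
   otherwise let 0 count as primitive. *)
definition primitive_element :: "'a::{field,finite} \<Rightarrow> bool" where
  "primitive_element e \<longleftrightarrow> e \<noteq> 0 \<and> (\<forall>x. x \<noteq> 0 \<longrightarrow> (\<exists>n::nat. x = e ^ n))"

(* The integers t and d may be negative, hence powi; every b that occurs is nonzero. *)
definition of_class_with ::
    "nat \<Rightarrow> int \<Rightarrow> int \<Rightarrow> ('a::{field,finite} \<Rightarrow> 'a poly) \<Rightarrow> bool" where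
  "of_class_with \<Delta> t d f \<longleftrightarrow>
     (\<forall>b. b ^ ((CARD('a) - 1) div \<Delta>) = 1 \<longrightarrow>
        (\<forall>a x. poly (f a) (b * x) = b powi t * poly (f (a * b powi d)) x))"

end

theory Submission
  imports Defs
begin

text \<open>Substituting \<open>x \<mapsto> b x\<close> and scaling by \<open>b\<^sup>t\<close> are bijections, so membership in a
  class makes \<open>f\<^sub>a\<close> and \<open>f\<^bsub>ab^d\<^esub>\<close> permutations simultaneously. The admissible \<open>b\<close> include the
  powers of \<open>\<epsilon>\<^sup>\<Delta>\<close>, so the exponent \<open>n\<close> in \<open>a = \<epsilon>\<^sup>n\<close> matters only modulo \<open>\<Delta>d\<close>; since also
  \<open>\<epsilon>\<^bsup>q-1\<^esup> = 1\<close>, it matters only modulo \<open>gcd (q - 1) (\<Delta>d)\<close> by Bezout.\<close>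

text \<open>Multiplication by \<open>x\<close> permutes the nonzero elements, so their product is
  unchanged when scaled by the power of \<open>x\<close>; being nonzero, it cancels.\<close>

lemma power_card_minus_1_eq_1:
  fixes x :: "'a::{field,finite}"
  assumes "x \<noteq> 0"
  shows "x ^ (CARD('a) - 1) = 1"
proof -
  let ?U = "UNIV - {0 :: 'a}"
  have "bij_betw ((*) x) ?U ?U"
    by (rule bij_betw_byWitness[where f' = "\<lambda>y. y / x"]) (use assms in auto)
  then have "(\<Prod>y\<in>?U. x * y) = \<Prod>?U"
    by (rule prod.reindex_bij_betw)
  then have "x ^ card ?U * \<Prod>?U = \<Prod>?U"
    by (simp add: prod.distrib)
  then show ?thesis
    by simp
qed

text \<open>With \<open>\<Delta>\<close> arbitrary, the exponent can be 0, and the power condition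
  then allows \<open>b = 0\<close>; hence the separate assumption.\<close>

lemma permutation_polynomial_of_class_iff:
  fixes f :: "'a::{field,finite} \<Rightarrow> 'a poly"
  assumes "of_class_with \<Delta> t d f" "b ^ ((CARD('a) - 1) div \<Delta>) = 1" "b \<noteq> 0"
  shows "permutation_polynomial (f (a * b powi d)) \<longleftrightarrow> permutation_polynomial (f a)"
proof -
  let ?g = "poly (f (a * b powi d))"
  have bij_mult: "bij ((*) c)" if "c \<noteq> 0" for c :: 'a
    by (rule bij_betw_byWitness[where f' = "\<lambda>y. y / c"]) (use that in auto)
  have "poly (f a) \<circ> (*) b = (*) (b powi t) \<circ> ?g"
    using assms(1,2) by (auto simp: of_class_with_def)
  moreover have "bij (poly (f a) \<circ> (*) b) \<longleftrightarrow> bij (poly (f a))"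
    using bij_betw_comp_iff[OF bij_mult[OF \<open>b \<noteq> 0\<close>]] by blast
  moreover have "bij ((*) (b powi t) \<circ> ?g) \<longleftrightarrow> bij ?g"
    using bij_betw_comp_iff2[OF bij_mult, of "b powi t" ?g UNIV] \<open>b \<noteq> 0\<close> by simp
  ultimately show ?thesis
    by (simp add: permutation_polynomial_def)
qed

theorem theorem6:
  fixes h\<^sub>1 h\<^sub>2 :: "'a::{field,finite} poly"
    and f :: "'a \<Rightarrow> 'a poly"
    and q \<Delta> :: nat
    and t d :: int
    and \<epsilon> :: 'a
  assumes q: "q = CARD('a)"
    and h2_additive: "Modules.additive (poly h\<^sub>2)"
    and f: "\<And>a. f a = h\<^sub>1 + pcompose h\<^sub>2 [:0, a:] + [:0, a\<^sup>2:]"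
    and Delta: "\<Delta> > 0" "\<Delta> dvd q - 1"
    and f_class: "of_class_with \<Delta> t d f"
    and primitive: "primitive_element \<epsilon>"
  shows "(\<forall>a. permutation_polynomial (f a)) \<longleftrightarrow>
         permutation_polynomial (f 0) \<and>
         (\<forall>r::int. 0 \<le> r \<and> r < gcd (int q - 1) (int \<Delta> * d) \<longrightarrow>
            permutation_polynomial (f (\<epsilon> powi r)))"
proof (intro iffI conjI allI impI)
  fix a
  let ?P = "\<lambda>a. permutation_polynomial (f a)"
  define g where "g = gcd (int q - 1) (int \<Delta> * d)"
  assume R: "?P 0 \<and> (\<forall>r. 0 \<le> r \<and> r < gcd (int q - 1) (int \<Delta> * d) \<longrightarrow> ?P (\<epsilon> powi r))"
  \<comment> \<open>From \<open>q \<ge> 2\<close>, truncated \<open>q - 1\<close> agrees with the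
    integer difference and is positive, so \<open>g > 0\<close> even if
    \<open>d = 0\<close>.\<close>
  have "card {0, 1 :: 'a} \<le> q"
    unfolding q by (rule card_mono) auto
  then have "2 \<le> q"
    by simp
  have nz: "\<epsilon> \<noteq> 0"
    using primitive by (simp add: primitive_element_def)
  have order: "\<epsilon> powi (int q - 1) = 1"
    using power_card_minus_1_eq_1[OF nz] \<open>2 \<le> q\<close> power_int_of_nat[of \<epsilon> "q - 1"]
    by (simp add: q of_nat_diff)
  show "?P a"
  proof (cases "a = 0")
    case True
    then show ?thesis using R by simp
  next
    case False
    then obtain n :: nat where n: "a = \<epsilon> ^ n"
      using primitive by (auto simp: primitive_element_def)
    define r where "r = int n mod g"
    define k where "k = int n div g"
    have "g > 0"
      using \<open>2 \<le> q\<close> by (simp add: g_def gcd_pos_int)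
    then have "?P (\<epsilon> powi r)"
      using R by (simp add: r_def g_def)
    obtain u v where uv: "u * (int q - 1) + v * (int \<Delta> * d) = g"
      using bezout_int unfolding g_def by blast
    \<comment> \<open>Multiplying the Bezout identity by \<open>k\<close> splits
      \<open>n - r = g * k\<close> into a multiple of \<open>q - 1\<close>, invisible in the
      exponent of \<open>\<epsilon>\<close>, and \<open>\<Delta> * v * k * d\<close>, which is the
      contribution of \<open>b powi d\<close>.\<close>
    define b where "b = \<epsilon> powi (int \<Delta> * (v * k))"
    have "b \<noteq> 0"
      using nz by (simp add: b_def)
    have "b ^ ((q - 1) div \<Delta>) = \<epsilon> powi ((int q - 1) * (v * k))"
    proof -
      \<comment> \<open>The division is exact because \<open>\<Delta>\<close> divides
        \<open>q - 1\<close>; this makes \<open>b\<close> admissible.\<close>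
      have "int \<Delta> * int ((q - 1) div \<Delta>) = int q - 1"
        using Delta(2) \<open>2 \<le> q\<close> by (simp flip: of_nat_mult add: of_nat_diff)
      then have "int \<Delta> * (v * k) * int ((q - 1) div \<Delta>) = (int q - 1) * (v * k)"
        by (metis mult.assoc mult.commute)
      then show ?thesis
        unfolding b_def power_int_power' by (rule arg_cong)
    qed
    also have "\<dots> = 1"
      by (simp add: power_int_mult order)
    finally have b: "b ^ ((CARD('a) - 1) div \<Delta>) = 1"
      by (simp add: q)
    have "int n = r + (int q - 1) * (u * k) + int \<Delta> * (v * k) * d"
    proof -
      have "int n = r + g * k"
        by (simp add: r_def k_def)
      then show ?thesis
        by (simp add: uv[symmetric] algebra_simps)
    qed
    then have "\<epsilon> powi int n = \<epsilon> powi r * (\<epsilon> powi (int q - 1)) powi (u * k) * b powi d"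
      using nz by (simp add: b_def power_int_add power_int_mult)
    then have "a = \<epsilon> powi r * b powi d"
      by (simp add: n order)
    then show ?thesis
      using permutation_polynomial_of_class_iff[OF f_class b \<open>b \<noteq> 0\<close>] \<open>?P (\<epsilon> powi r)\<close> by simp
  qed
qed auto

end
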